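(* Let $P>0$, let $q_n\in[0,1]$ and $\sigma_n^2>0$ be the parameters of $N$ channels, let $L\le N$, and let $\lambda_{min}>0$ be the water level output by the coarse optimization procedure (defined in the context). Suppose the channels $n$ with $\sigma_n^2\le\lambda_{min}$ are indexed $1,\dots,M$. Let $(\lambda, I_1,\dots,I_M)$ be an optimal solution of $$\max_{\lambda,I_n}\ \sum_{n=1}^M \frac{q_nI_n}{2}\log\frac{\lambda}{\sigma_n^2}$$ subject to $$\sum_{n=1}^M(\lambda-\sigma_n^2)I_nq_n=P,\qquad \sum_{n=1}^M I_n\le L,\qquad \lambda\ge\lambda_{min},\qquad I_n\in\{0,1\}.$$ Then $$\lambda=\frac{\sum_{n=1}^M q_nI_n\sigma_n^2+P}{\sum_{n=1}^M q_nI_n},$$ and $$I_n=0\quad\text{if}\quad \lambda\le\sigma_n^2\,e^{\,1-\sigma_n^2/\lambda}.$$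
   Context: Notation: $\lceil w\rceil^+=\max(0,w)$ (not a ceiling); the logarithm is to any fixed base greater than $1$. Coarse optimization procedure, with inputs $N$, $L\le N$, $P$, $q_n$, $\sigma_n^2$ ($1\le n\le N$): (I) Start with an initial set of $L$ channels, e.g. $I_{n,0}=1$ if $q_n$ is among the $L$ largest and $I_{n,0}=0$ otherwise; put $S_0=\{n: I_{n,0}=1\}$ and $j=1$. (II) Let $\lambda_j$ solve $\sum_{n=1}^N\lceil\lambda_j-\sigma_n^2\rceil^+I_{n,j-1}q_n=P$. (III) Put $I_{n,j}=1$ if $q_n(\lambda_j-\sigma_n^2)>0$ and $q_n(\lambda_j-\sigma_n^2)$ is among the $L$ largest of these values over $n\in\{1,\dots,N\}$, and $I_{n,j}=0$ otherwise; put $S_j=\{n:I_{n,j}=1\}$. (IV) If $S_j=S_{j-1}$, stop and output $\lambda_{min}=\lambda_j$ and the selected set $S_c=S_j$; otherwise increase $j$ by $1$ and return to (II). The problem in the claim is considered in the case where the procedure terminates and $S_c$ has exactly $L$ elements. *)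

theory Defs
  imports Complex_Main
begin

text \<open>
  Channels are the numbers \<open>1, \<dots>, N\<close>; \<open>q n\<close> is the parameter $q_n$ and \<open>v n\<close> is the noise
  variance $\sigma_n^2$.  A 0/1 vector $(I_{n,j})_n$ of the coarse procedure is represented by its
  support \<open>S j\<close>, so that $I_{n,j}$ is \<open>of_bool (n \<in> S j)\<close>.
\<close>

text \<open>
  \<open>T\<close> consists of \<open>L\<close> elements of \<open>A\<close> with the largest values of \<open>f\<close>.  This is a relation and not
  a function because ties may be broken in any way.
\<close>
definition L_largest :: "nat \<Rightarrow> (nat \<Rightarrow> real) \<Rightarrow> nat set \<Rightarrow> nat set \<Rightarrow> bool" where
  "L_largest L f A T \<longleftrightarrow>
     T \<subseteq> A \<and> card T = L \<and> (\<forall>m\<in>T. \<forall>n\<in>A - T. f n \<le> f m)"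

definition water_level ::
    "nat \<Rightarrow> real \<Rightarrow> (nat \<Rightarrow> real) \<Rightarrow> (nat \<Rightarrow> real) \<Rightarrow> nat set \<Rightarrow> real \<Rightarrow> bool" where
  "water_level N P q v S lam \<longleftrightarrow>
     (\<Sum>n=1..N. max 0 (lam - v n) * of_bool (n \<in> S) * q n) = P"

definition select_channels ::
    "nat \<Rightarrow> nat \<Rightarrow> (nat \<Rightarrow> real) \<Rightarrow> (nat \<Rightarrow> real) \<Rightarrow> real \<Rightarrow> nat set \<Rightarrow> bool" where
  "select_channels N L q v lam S \<longleftrightarrow>
     (\<exists>T. L_largest L (\<lambda>n. q n * (lam - v n)) {1..N} T \<and>
          S = {n \<in> T. q n * (lam - v n) > 0})"

text \<open>
  Some terminating run of the procedure, with iterations \<open>1, \<dots>, J\<close>, outputs the water level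
  \<open>lam_min\<close> and the selected set \<open>Sc\<close>.  The initial set may be any set of \<open>L\<close> channels.
\<close>
definition coarse_output ::
    "nat \<Rightarrow> nat \<Rightarrow> real \<Rightarrow> (nat \<Rightarrow> real) \<Rightarrow> (nat \<Rightarrow> real) \<Rightarrow> real \<Rightarrow> nat set \<Rightarrow> bool" where
  "coarse_output N L P q v lam_min Sc \<longleftrightarrow>
     (\<exists>(J::nat) (lam :: nat \<Rightarrow> real) (S :: nat \<Rightarrow> nat set).
        1 \<le> J \<and>
        S 0 \<subseteq> {1..N} \<and> card (S 0) = L \<and>
        (\<forall>j\<in>{1..J}. water_level N P q v (S (j - 1)) (lam j) \<and>
                    select_channels N L q v (lam j) (S j)) \<and>
        (\<forall>j\<in>{1..<J}. S j \<noteq> S (j - 1)) \<and>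
        S J = S (J - 1) \<and>
        lam_min = lam J \<and> Sc = S J)"

definition objective ::
    "real \<Rightarrow> nat \<Rightarrow> (nat \<Rightarrow> real) \<Rightarrow> (nat \<Rightarrow> real) \<Rightarrow> real \<times> (nat \<Rightarrow> real) \<Rightarrow> real" where
  "objective b M q v = (\<lambda>(lam, I). \<Sum>n=1..M. q n * I n / 2 * log b (lam / v n))"

definition feasible ::
    "nat \<Rightarrow> nat \<Rightarrow> real \<Rightarrow> (nat \<Rightarrow> real) \<Rightarrow> (nat \<Rightarrow> real) \<Rightarrow> real \<Rightarrow> real \<times> (nat \<Rightarrow> real) \<Rightarrow> bool" where
  "feasible M L P q v lam_min = (\<lambda>(lam, I).
     (\<Sum>n=1..M. (lam - v n) * I n * q n) = P \<and>
     (\<Sum>n=1..M. I n) \<le> real L \<and>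
     lam \<ge> lam_min \<and>
     (\<forall>n\<in>{1..M}. I n \<in> {0, 1}))"

end

(* Since ln y \<le> y - 1 with equality only at y = 1, the exponential condition on channel n forces
   \<lambda> = v n, hence \<lambda> = \<lambda>_min = v n.  If I n = 1, channel n contributes nothing to the power
   constraint, so fewer than L channels would use the full power P at level \<lambda>_min.  But P is the
   power used by S_c, which consists of the L largest values q n (\<lambda>_min - v n), all positive, and
   fewer than L channels always use strictly less. *)
theory Submission
  imports Defs
begin

text \<open>Exchange argument: cancel the common part of \<open>B\<close> and \<open>T\<close>.
  Every value on \<open>B - T\<close> is at most every value on \<open>T - B\<close>, so the least
  value on \<open>T - B\<close> separates the two; it is positive and \<open>B - T\<close> has fewer
  elements, which makes the comparison strict.\<close>

lemma L_largest_sum_less: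
  fixes f :: "nat \<Rightarrow> real"
  assumes T: "L_largest L f A T" and A: "finite A"
    and pos: "\<And>m. m \<in> T \<Longrightarrow> 0 < f m"
    and B: "B \<subseteq> A" "card B < L"
  shows "sum f B < sum f T"
proof -
  have TA: "T \<subseteq> A" and cT: "card T = L" and ge: "\<And>m n. m \<in> T \<Longrightarrow> n \<in> A - T \<Longrightarrow> f n \<le> f m"
    using T by (auto simp: L_largest_def)
  have fin: "finite T" "finite B"
    using TA B(1) A finite_subset by blast+
  have "card (B - T) + card (B \<inter> T) = card B" "card (T - B) + card (B \<inter> T) = card T"
    using fin by (simp_all add: card_Diff_subset_Int Int_commute card_mono)
  then have card: "card (B - T) < card (T - B)"
    using B(2) cT by linarith
  then have ne: "T - B \<noteq> {}"
    by (metis card.empty not_less_zero)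
  define c where "c = Min (f ` (T - B))"
  have "c \<in> f ` (T - B)"
    unfolding c_def using ne fin by (intro Min_in) auto
  then obtain m where m: "m \<in> T - B" "c = f m"
    by blast
  have "sum f (B - T) \<le> of_nat (card (B - T)) * c"
    using m ge B(1) by (intro sum_bounded_above) auto
  also have "\<dots> < of_nat (card (T - B)) * c"
    using card pos m by simp
  also have "\<dots> \<le> sum f (T - B)"
    using fin by (intro sum_bounded_below) (auto simp: c_def)
  finally have "sum f (B - T) + sum f (B \<inter> T) < sum f (T - B) + sum f (B \<inter> T)"
    by simp
  then show ?thesis
    using fin by (metis Int_commute add.commute sum.Int_Diff)
qed

text \<open>Selection discards the nonpositive values among the \<open>L\<close> largest. If
  \<open>L\<close> channels survive, nothing was discarded, so \<open>Sc\<close> is the whole set of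
  \<open>L\<close> largest.\<close>

lemma coarse_output_full:
  assumes "coarse_output N L P q v lam Sc" and "card Sc = L"
  shows "L_largest L (\<lambda>n. q n * (lam - v n)) {1..N} Sc"
    and "\<And>n. n \<in> Sc \<Longrightarrow> 0 < q n * (lam - v n)"
    and "water_level N P q v Sc lam"
proof -
  obtain J :: nat and l S where J: "1 \<le> J"
    and step: "\<forall>j\<in>{1..J}. water_level N P q v (S (j - 1)) (l j) \<and> select_channels N L q v (l j) (S j)"
    and S: "S J = S (J - 1)" "lam = l J" "Sc = S J"
    using assms(1) unfolding coarse_output_def by blast
  have J': "J \<in> {1..J}"
    using J by simp
  \<comment> \<open>The level \<open>l J\<close> was computed from \<open>S (J - 1)\<close>; the
    stopping condition identifies that set with \<open>Sc\<close>.\<close>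
  then show "water_level N P q v Sc lam"
    using step S by metis
  have "select_channels N L q v lam Sc"
    using step S J' by metis
  then obtain T where T: "L_largest L (\<lambda>n. q n * (lam - v n)) {1..N} T"
    and Sc: "Sc = {n \<in> T. q n * (lam - v n) > 0}"
    unfolding select_channels_def by blast
  have "finite T" "card T = L"
    using T finite_subset by (auto simp: L_largest_def)
  then have "Sc = T"
    using Sc assms(2) by (intro card_subset_eq) auto
  then show "L_largest L (\<lambda>n. q n * (lam - v n)) {1..N} Sc"
    using T by simp
  show "0 < q n * (lam - v n)" if "n \<in> Sc" for n
    using that Sc by simp
qed

text \<open>The truncation at 0 is inactive on \<open>Sc\<close>: a positive product with
  \<open>q n\<close> nonnegative forces \<open>lam - v n\<close> to be positive.\<close>

lemma coarse_output_power:
  assumes q: "\<And>n. n \<in> {1..N} \<Longrightarrow> 0 \<le> q n"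
    and out: "coarse_output N L P q v lam Sc" "card Sc = L"
  shows "(\<Sum>n\<in>Sc. q n * (lam - v n)) = P"
proof -
  note full = coarse_output_full[OF out]
  have sub: "Sc \<subseteq> {1..N}"
    using full(1) by (simp add: L_largest_def)
  have eq: "max 0 (lam - v n) * q n = q n * (lam - v n)" if "n \<in> Sc" for n
  proof -
    have "0 \<le> lam - v n"
      using full(2)[OF that] q[of n] sub that by (auto simp: zero_less_mult_iff)
    then show ?thesis
      by simp
  qed
  have "P = (\<Sum>n=1..N. max 0 (lam - v n) * of_bool (n \<in> Sc) * q n)"
    using full(3) by (simp add: water_level_def)
  also have "\<dots> = (\<Sum>n\<in>Sc. max 0 (lam - v n) * of_bool (n \<in> Sc) * q n)"
    using sub by (intro sum.mono_neutral_right) auto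
  also have "\<dots> = (\<Sum>n\<in>Sc. q n * (lam - v n))"
    using eq by (intro sum.cong) auto
  finally show ?thesis
    by simp
qed

text \<open>Taking logarithms yields y - 1 \<le> ln y for y = \<open>a / x\<close>, the reverse of
  the standard bound, so only its equality case remains.\<close>

lemma le_mult_exp_imp_eq:
  fixes x a :: real
  assumes "0 < x" "0 < a" "x \<le> a * exp (1 - a / x)"
  shows "x = a"
proof -
  have "ln x \<le> ln (a * exp (1 - a / x))"
    using assms by simp
  also have "\<dots> = ln a + (1 - a / x)"
    using assms by (simp add: ln_mult)
  finally have "a / x - 1 \<le> ln (a / x)"
    using assms by (simp add: ln_div)
  then have "ln (a / x) = a / x - 1"
    using assms ln_le_minus_one[of "a / x"] by simp
  then have "a / x = 1"
    using assms by (intro ln_eq_minus_one) auto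
  then show ?thesis
    using assms by simp
qed

theorem theorem2:
  fixes N L M :: nat and P b lam_min lam :: real
    and q v I :: "nat \<Rightarrow> real" and Sc :: "nat set"
  assumes "b > 1"
    and "P > 0"
    and "\<And>n. n \<in> {1..N} \<Longrightarrow> 0 \<le> q n \<and> q n \<le> 1"
    and "\<And>n. n \<in> {1..N} \<Longrightarrow> v n > 0"
    and "L \<le> N"
    and "coarse_output N L P q v lam_min Sc"
    and "card Sc = L"
    and "lam_min > 0"
    and "{n \<in> {1..N}. v n \<le> lam_min} = {1..M}"
    and "is_arg_max (objective b M q v) (feasible M L P q v lam_min) (lam, I)"
  shows "lam = ((\<Sum>n=1..M. q n * I n * v n) + P) / (\<Sum>n=1..M. q n * I n) \<and>
         (\<forall>n\<in>{1..M}. lam \<le> v n * exp (1 - v n / lam) \<longrightarrow> I n = 0)"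
proof (intro conjI ballI impI)
  have power: "(\<Sum>n=1..M. (lam - v n) * I n * q n) = P"
    and size: "(\<Sum>n=1..M. I n) \<le> real L" and lam: "lam \<ge> lam_min"
    and I: "\<And>n. n \<in> {1..M} \<Longrightarrow> I n \<in> {0, 1}"
    using assms(10) by (auto simp: is_arg_max_def feasible_def)
  have q: "0 \<le> q n" "q n \<le> 1" if "n \<in> {1..N}" for n
    using assms(3) that by auto
  have M: "n \<in> {1..N}" "v n \<le> lam_min" if "n \<in> {1..M}" for n
    using assms(9) that by blast+

  have split: "P = lam * (\<Sum>n=1..M. q n * I n) - (\<Sum>n=1..M. q n * I n * v n)"
    unfolding power[symmetric] sum_distrib_left sum_subtractf[symmetric]
    by (intro sum.cong) (auto simp: algebra_simps)
  \<comment> \<open>If this sum of nonnegative terms vanished, each term would, and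
    \<open>split\<close> would give P = 0.\<close>
  have "(\<Sum>n=1..M. q n * I n) \<noteq> 0"
  proof
    assume 0: "(\<Sum>n=1..M. q n * I n) = 0"
    moreover have "0 \<le> q n * I n" if "n \<in> {1..M}" for n
      using q(1)[OF M(1)[OF that]] I[OF that] by auto
    ultimately have "\<And>n. n \<in> {1..M} \<Longrightarrow> q n * I n = 0"
      by (subst (asm) sum_nonneg_eq_0_iff) auto
    then have "(\<Sum>n=1..M. q n * I n * v n) = 0"
      by (intro sum.neutral) simp
    then show False
      using split 0 assms(2) by simp
  qed
  then show "lam = ((\<Sum>n=1..M. q n * I n * v n) + P) / (\<Sum>n=1..M. q n * I n)"
    using split by (simp add: field_simps)

  fix k
  assume k: "k \<in> {1..M}" and le: "lam \<le> v k * exp (1 - v k / lam)"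
  have "lam = v k"
    using le_mult_exp_imp_eq[OF _ _ le] lam assms(4,8) M(1)[OF k] by simp
  \<comment> \<open>The chain \<open>v k\<close> \<le> \<open>lam_min\<close> \<le>
    \<open>lam\<close> = \<open>v k\<close> collapses.\<close>
  then have eq: "lam = lam_min" "v k = lam_min"
    using lam M(2)[OF k] by auto
  show "I k = 0"
  proof (rule ccontr)
    assume "I k \<noteq> 0"
    \<comment> \<open>Passing to the support of \<open>I\<close> turns the bound on its sum into a
      bound on a cardinality.\<close>
    define A where "A = {n \<in> {1..M}. I n = 1}"
    have kA: "k \<in> A" and fin: "finite A"
      using I[OF k] \<open>I k \<noteq> 0\<close> k by (auto simp: A_def)
    have off: "I n = 0" if "n \<in> {1..M} - A" for n
      using I[of n] that by (auto simp: A_def)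
    have "(\<Sum>n=1..M. I n) = (\<Sum>n\<in>A. I n)"
      using off by (intro sum.mono_neutral_right) (auto simp: A_def)
    then have "(\<Sum>n=1..M. I n) = real (card A)"
      by (simp add: A_def)
    then have "card A \<le> L"
      using size by simp
    then have card: "card (A - {k}) < L"
      using card_Diff1_less[OF fin kA] by simp
    have "P = (\<Sum>n\<in>A. (lam - v n) * I n * q n)"
      unfolding power[symmetric] using off by (intro sum.mono_neutral_right) (auto simp: A_def)
    also have "\<dots> = (\<Sum>n\<in>A. q n * (lam_min - v n))"
      by (intro sum.cong) (auto simp: A_def eq)
    also have "\<dots> = (\<Sum>n\<in>A - {k}. q n * (lam_min - v n))"
      using fin eq(2) kA by (simp add: sum.remove)
    \<comment> \<open>Both sums use the same level \<open>lam_min\<close>, so the sets are compared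
      under the very values by which \<open>Sc\<close> was selected.\<close>
    also have "\<dots> < (\<Sum>n\<in>Sc. q n * (lam_min - v n))"
      using coarse_output_full(1,2)[OF assms(6,7)] card M(1)
      by (intro L_largest_sum_less[where A = "{1..N}"]) (auto simp: A_def)
    also have "\<dots> = P"
      using coarse_output_power[OF q(1) assms(6,7)] by simp
    finally show False
      by simp
  qed
qed

end
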